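(* Let $G$ be a connected graph with $n$ vertices and $m$ edges. Then $$BH(G)\leq \frac{n(n-1)^2}{4(2m+M_1(G))}\left(r_L(G)+\frac{1}{r_L(G)}\right)^{2}.$$
   Context: For a graph $G$ with vertex set $\{1,\dots,n\}$, $L(G)=D(G)-A(G)$ is its Laplacian matrix (degree diagonal matrix minus adjacency matrix), with eigenvalues $0=\lambda_1\le\lambda_2\le\cdots\le\lambda_n$; for connected $G$ with $n\ge 2$, $\lambda_2>0$. The biharmonic index is $BH(G)=\frac12\sum_{u,v\in V(G)}d_B^2(u,v)$, where $d_B^2(u,v)=(e_u-e_v)^T (L^{+})^2(e_u-e_v)$ is the squared biharmonic distance ($L^+$ the Moore–Penrose pseudoinverse); equivalently $BH(G)=n\sum_{i=2}^n \lambda_i^{-2}$. The first Zagreb index is $M_1(G)=\sum_{v\in V(G)}d(v)^2$, $d(v)$ the degree of $v$. The Laplacian spectral ratio is $r_L(G)=\lambda_n/\lambda_2$. *)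

theory Defs
  imports "Jordan_Normal_Form.Char_Poly"
begin

text \<open>
  A simple graph on \<open>n\<close> vertices has vertex set \<open>{..<n}\<close>, because the rows and columns of an
  \<open>n \<times> n\<close> matrix are indexed from 0, and is given by its set \<open>E\<close> of unordered edges.
\<close>

definition simple_graph :: "nat \<Rightarrow> nat set set \<Rightarrow> bool" where
  "simple_graph n E \<longleftrightarrow> (\<forall>e\<in>E. e \<subseteq> {..<n} \<and> card e = 2)"

definition connected_graph :: "nat \<Rightarrow> nat set set \<Rightarrow> bool" where
  "connected_graph n E \<longleftrightarrow> simple_graph n E \<and> n > 0 \<and>
     (\<forall>u<n. \<forall>v<n. (u, v) \<in> {(x, y). {x, y} \<in> E}\<^sup>*)"

definition degree_of :: "nat set set \<Rightarrow> nat \<Rightarrow> nat" where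
  "degree_of E v = card {e \<in> E. v \<in> e}"

definition zagreb1 :: "nat \<Rightarrow> nat set set \<Rightarrow> nat" where
  "zagreb1 n E = (\<Sum>v<n. (degree_of E v)\<^sup>2)"

definition adjacency_mat :: "nat \<Rightarrow> nat set set \<Rightarrow> real mat" where
  "adjacency_mat n E = mat n n (\<lambda>(i, j). if {i, j} \<in> E then 1 else 0)"

definition degree_mat :: "nat \<Rightarrow> nat set set \<Rightarrow> real mat" where
  "degree_mat n E = mat n n (\<lambda>(i, j). if i = j then real (degree_of E i) else 0)"

definition laplacian :: "nat \<Rightarrow> nat set set \<Rightarrow> real mat" where
  "laplacian n E = degree_mat n E - adjacency_mat n E"

text \<open>
  The real eigenvalues of a matrix, with algebraic multiplicity, in increasing order. For a real
  symmetric \<open>n \<times> n\<close> matrix such as the Laplacian, this is the full list of its \<open>n\<close> eigenvalues.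
  The index of \<open>lap_eig\<close> starts at 1: \<open>lap_eig n E i\<close> is \<open>\<lambda>\<^sub>i\<close> for \<open>1 \<le> i \<le> n\<close>.
\<close>

definition sorted_eigenvalues :: "real mat \<Rightarrow> real list" where
  "sorted_eigenvalues A = sorted_list_of_multiset (proots (char_poly A))"

definition lap_eig :: "nat \<Rightarrow> nat set set \<Rightarrow> nat \<Rightarrow> real" where
  "lap_eig n E i = sorted_eigenvalues (laplacian n E) ! (i - 1)"

definition spectral_ratio :: "nat \<Rightarrow> nat set set \<Rightarrow> real" where
  "spectral_ratio n E = lap_eig n E n / lap_eig n E 2"

text \<open>
  The four Penrose conditions. Over the reals the conjugate transpose is the transpose. Every real
  matrix \<open>A\<close> has exactly one such \<open>X\<close>.
\<close>

definition is_pinverse :: "real mat \<Rightarrow> real mat \<Rightarrow> bool" where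
  "is_pinverse A X \<longleftrightarrow> X \<in> carrier_mat (dim_col A) (dim_row A) \<and>
     A * X * A = A \<and> X * A * X = X \<and>
     transpose_mat (A * X) = A * X \<and> transpose_mat (X * A) = X * A"

definition pinverse :: "real mat \<Rightarrow> real mat" where
  "pinverse A = (THE X. is_pinverse A X)"

definition biharmonic_dist_sq :: "nat \<Rightarrow> nat set set \<Rightarrow> nat \<Rightarrow> nat \<Rightarrow> real" where
  "biharmonic_dist_sq n E u v =
     (let x = unit_vec n u - unit_vec n v
      in x \<bullet> (pinverse (laplacian n E) ^\<^sub>m 2 *\<^sub>v x))"

definition biharmonic_index :: "nat \<Rightarrow> nat set set \<Rightarrow> real" where
  "biharmonic_index n E = 1 / 2 * (\<Sum>u<n. \<Sum>v<n. biharmonic_dist_sq n E u v)"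

end

theory Submission
  imports Defs "HOL-Computational_Algebra.Fundamental_Theorem_Algebra"
begin

text \<open>
  Diagonalise the Laplacian orthogonally, with eigenvalues \<open>\<lambda>\<^sub>i\<close>. The constant vectors
  lie in the kernel of \<open>L\<^sup>+\<close>, so summing the squared distances over all pairs gives \<open>n\<close> times the
  trace of \<open>(L\<^sup>+)\<^sup>2\<close>, that is \<open>BH = n \<Sum> \<lambda>\<^sub>i\<^sup>-\<^sup>2\<close> over the nonzero eigenvalues, of which
  connectedness leaves \<open>n - 1\<close>. On the other hand \<open>\<Sum> \<lambda>\<^sub>i\<^sup>2\<close> is the trace of \<open>L\<^sup>2\<close>, which is
  \<open>2m + M\<^sub>1\<close>. The bound is then the Kantorovich inequality for the numbers
  \<open>\<lambda>\<^sub>2\<^sup>2, \<dots>, \<lambda>\<^sub>n\<^sup>2\<close>.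
\<close>

section \<open>The spectral theorem for real symmetric matrices\<close>

text \<open>The fundamental theorem of algebra gives a complex root \<open>z\<close> of the
  characteristic polynomial. Symmetry forces \<open>z\<close> to be real, and a real root of the
  real characteristic polynomial has a real eigenvector, which is then normalised.\<close>

lemma symmetric_real_eigenvector:
  fixes A :: "real mat"
  assumes A: "A \<in> carrier_mat n n" and sym: "transpose_mat A = A" and "n > 0"
  obtains v e where "v \<in> carrier_vec n" "v \<bullet> v = 1" "A *\<^sub>v v = e \<cdot>\<^sub>v v"
proof -
  let ?C = "map_mat complex_of_real A"
  have C: "?C \<in> carrier_mat n n" and symC: "transpose_mat ?C = ?C"
    using A arg_cong[OF sym, of "map_mat complex_of_real"] by (auto simp: map_mat_transpose)
  have "degree (char_poly ?C) \<noteq> 0"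
    using degree_monic_char_poly[OF C] \<open>n > 0\<close> by simp
  then obtain z where z: "poly (char_poly ?C) z = 0"
    using fundamental_theorem_of_algebra[of "char_poly ?C"] by (auto simp: constant_degree)
  then obtain x where x: "x \<in> carrier_vec n" "x \<noteq> 0\<^sub>v n" "?C *\<^sub>v x = z \<cdot>\<^sub>v x"
    using C unfolding eigenvalue_root_char_poly[OF C, symmetric] eigenvalue_def eigenvector_def
    by auto
  have conj: "conjugate (?C *\<^sub>v x) = ?C *\<^sub>v conjugate x"
    using A x(1) by (intro eq_vecI) (auto simp: scalar_prod_def)
  \<comment> \<open>The Hermitian form is evaluated with \<open>?C\<close> acting on either
    argument; as \<open>x\<close> is nonzero, comparing the results gives
    \<open>cnj z = z\<close>.\<close>
  have "z * (x \<bullet>c x) = (?C *\<^sub>v x) \<bullet>c x"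
    using x by simp
  also have "\<dots> = x \<bullet> (?C *\<^sub>v conjugate x)"
    using transpose_vec_mult_scalar[OF C carrier_vec_conjugate[OF x(1)] x(1)] symC by simp
  also have "\<dots> = cnj z * (x \<bullet>c x)"
    using x unfolding conj[symmetric] by (simp add: conjugate_smult_vec)
  finally have "cnj z = z"
    using x by simp
  then obtain e where e: "z = complex_of_real e"
    by (metis Reals_cnj_iff Reals_cases)
  have "poly (char_poly A) e = 0"
    using z unfolding of_real_hom.char_poly_hom[OF A] e by simp
  then obtain v where v: "v \<in> carrier_vec n" "v \<noteq> 0\<^sub>v n" "A *\<^sub>v v = e \<cdot>\<^sub>v v"
    using A unfolding eigenvalue_root_char_poly[OF A, symmetric] eigenvalue_def eigenvector_def
    by auto
  have pos: "v \<bullet> v > 0"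
    using conjugate_square_greater_0_vec[OF v(1)] v(2) by simp
  let ?c = "1 / sqrt (v \<bullet> v)"
  show thesis
  proof (rule that[of "?c \<cdot>\<^sub>v v" e])
    show "(?c \<cdot>\<^sub>v v) \<bullet> (?c \<cdot>\<^sub>v v) = 1"
      using v(1) pos by (simp add: field_simps)
    show "A *\<^sub>v (?c \<cdot>\<^sub>v v) = e \<cdot>\<^sub>v (?c \<cdot>\<^sub>v v)"
      using v A by (simp add: mult_mat_vec[OF A v(1)] smult_smult_assoc mult.commute)
  qed (use v in auto)
qed

text \<open>Two distinct unit vectors are exchanged by the reflection in the hyperplane orthogonal
  to their difference, and a reflection is symmetric and its own inverse. Here \<open>w\<close> is
  the difference of \<open>v\<close> and \<open>unit_vec n 0\<close>.\<close>

lemma householder: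
  fixes v :: "real vec"
  assumes v: "v \<in> carrier_vec n" and norm: "v \<bullet> v = 1" and "n > 0"
  obtains W where "W \<in> carrier_mat n n" "transpose_mat W = W" "W * W = 1\<^sub>m n"
    "W *\<^sub>v unit_vec n 0 = v"
proof -
  define w where "w i = v $ i - (if i = 0 then 1 else 0)" for i
  define s where "s = (\<Sum>i<n. w i * w i)"
  \<comment> \<open>\<open>c = 0\<close> in the degenerate case \<open>v = unit_vec n 0\<close>, where \<open>W\<close> is the identity.\<close>
  define c where "c = 2 / s"
  define W where "W = mat n n (\<lambda>(i, j). (if i = j then 1 else 0) - c * w i * w j)"
  have W: "W \<in> carrier_mat n n"
    by (simp add: W_def)
  \<comment> \<open>Division by zero yields 0, so this covers \<open>s = 0\<close> as well; it
    cancels the rank-one terms in \<open>W * W\<close>.\<close>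
  have cs: "c * c * s = 2 * c"
    by (simp add: c_def)
  \<comment> \<open>Since \<open>v\<close> has length 1, the squared length of \<open>w\<close> is 2
    - 2 \<open>v $ 0\<close>.\<close>
  have "s = (\<Sum>i<n. v $ i * v $ i - (if i = 0 then 2 * v $ 0 - 1 else 0))"
    unfolding s_def w_def by (intro sum.cong) (auto simp: algebra_simps)
  also have "\<dots> = (\<Sum>i<n. v $ i * v $ i) - (2 * v $ 0 - 1)"
    using \<open>n > 0\<close> by (simp add: sum_subtractf)
  also have "(\<Sum>i<n. v $ i * v $ i) = 1"
    using norm v by (simp add: scalar_prod_def lessThan_atLeast0)
  finally have s: "s = - 2 * w 0"
    by (simp add: w_def)
  \<comment> \<open>This determines column 0 of \<open>W\<close>: subtracting
    \<open>c * w i * w 0\<close> from the identity entry leaves \<open>v $ i\<close>.\<close>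
  have first: "c * w i * w 0 = - w i" if "i < n" for i
  proof (cases "s = 0")
    case True
    then have "w i * w i = 0"
      using that unfolding s_def by (subst (asm) sum_nonneg_eq_0_iff) auto
    then show ?thesis by simp
  next
    case False
    then show ?thesis using s by (simp add: c_def field_simps)
  qed
  show thesis
  proof
    show "transpose_mat W = W"
      by (rule eq_matI) (auto simp: W_def)
    show "W * W = 1\<^sub>m n"
    proof (rule eq_matI)
      fix i j assume "i < dim_row (1\<^sub>m n)" "j < dim_col (1\<^sub>m n)"
      then have ij: "i < n" "j < n" by auto
      have "(W * W) $$ (i, j) = (\<Sum>k<n. W $$ (i, k) * W $$ (k, j))"
        using ij W by (auto simp: scalar_prod_def lessThan_atLeast0)
      also have "\<dots> = (\<Sum>k<n. (if k = i then (if k = j then 1 else 0) - c * w i * w j else 0)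
          - (if k = j then c * w i * w j else 0) + c * c * w i * w j * (w k * w k))"
        using ij by (intro sum.cong) (auto simp: W_def algebra_simps)
      also have "\<dots> = (if i = j then 1 else 0) - 2 * c * w i * w j + (c * c * s) * w i * w j"
        using ij by (simp add: sum.distrib sum_subtractf s_def flip: sum_distrib_left)
      finally show "(W * W) $$ (i, j) = 1\<^sub>m n $$ (i, j)"
        using ij by (simp add: cs)
    qed (auto simp: W_def)
    show "W *\<^sub>v unit_vec n 0 = v"
    proof (rule eq_vecI)
      fix i assume "i < dim_vec v"
      with v have i: "i < n" by simp
      have "(W *\<^sub>v unit_vec n 0) $ i = W $$ (i, 0)"
        using i W \<open>n > 0\<close> by simp
      also have "\<dots> = v $ i"
        using i \<open>n > 0\<close> first[OF i] by (auto simp: W_def w_def)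
      finally show "(W *\<^sub>v unit_vec n 0) $ i = v $ i" .
    qed (use W v in auto)
  qed (fact W)
qed

text \<open>Induction on the dimension, splitting off one eigenvector at a time. Having
  \<open>transpose_mat U\<close> as the inverse in the similarity witness is what records that
  \<open>U\<close> is orthogonal.\<close>

theorem real_spectral_theorem:
  fixes A :: "real mat"
  assumes "A \<in> carrier_mat n n" and "transpose_mat A = A"
  obtains U f where "similar_mat_wit A (mat_diag n f) U (transpose_mat U)"
proof -
  have "\<exists>U f. similar_mat_wit A (mat_diag n f) U (transpose_mat U)"
    using assms
  proof (induction n arbitrary: A)
    case 0
    then have "similar_mat_wit A (mat_diag 0 (\<lambda>_. 0)) (1\<^sub>m 0) (transpose_mat (1\<^sub>m 0))"
      by (intro similar_mat_witI) (auto simp: mat_diag_def)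
    then show ?case by blast
  next
    case (Suc n)
    \<comment> \<open>Conjugating by a reflection that moves \<open>unit_vec ?N 0\<close> to an eigenvector splits off its
      eigenvalue as a \<open>1 \<times> 1\<close> block.\<close>
    let ?N = "Suc n"
    note A = Suc.prems(1) and sym = Suc.prems(2)
    obtain v e where v: "v \<in> carrier_vec ?N" "v \<bullet> v = 1" "A *\<^sub>v v = e \<cdot>\<^sub>v v"
      using symmetric_real_eigenvector[OF A sym] by auto
    obtain W where W: "W \<in> carrier_mat ?N ?N" and tW: "transpose_mat W = W"
      and WW: "W * W = 1\<^sub>m ?N" and W0: "W *\<^sub>v unit_vec ?N 0 = v"
      using householder[OF v(1,2)] by auto
    define B where "B = W * A * W"
    have B: "B \<in> carrier_mat ?N ?N"
      using A W by (simp add: B_def)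
    have tB: "transpose_mat B = B"
      using A W by (simp add: B_def transpose_mult[of _ ?N ?N _ ?N] tW sym assoc_mult_mat[of _ ?N ?N _ ?N _ ?N])
    have "W *\<^sub>v v = (W * W) *\<^sub>v unit_vec ?N 0"
      using W by (simp add: W0 assoc_mult_mat_vec[of _ ?N ?N _ ?N])
    then have Wv: "W *\<^sub>v v = unit_vec ?N 0"
      by (simp add: WW)
    have "B *\<^sub>v unit_vec ?N 0 = W *\<^sub>v (A *\<^sub>v (W *\<^sub>v unit_vec ?N 0))"
      using A W by (simp add: B_def assoc_mult_mat_vec[of _ ?N ?N _ ?N])
    also have "\<dots> = e \<cdot>\<^sub>v unit_vec ?N 0"
      using v W by (simp add: W0 mult_mat_vec[of _ ?N ?N] Wv)
    finally have B0: "B *\<^sub>v unit_vec ?N 0 = e \<cdot>\<^sub>v unit_vec ?N 0" .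
    \<comment> \<open>Column 0 of \<open>B\<close> is a multiple of the unit vector, and by symmetry
      so is row 0; hence \<open>B\<close> is block diagonal.\<close>
    have Bi0: "B $$ (i, 0) = (if i = 0 then e else 0)" if "i < ?N" for i
      using arg_cong[OF B0, of "\<lambda>x. x $ i"] that B by (auto split: if_splits)
    have Bsym: "B $$ (i, j) = B $$ (j, i)" if "i < ?N" "j < ?N" for i j
      using arg_cong[OF tB, of "\<lambda>M. M $$ (i, j)"] that B by auto
    define D where "D = mat n n (\<lambda>(i, j). B $$ (Suc i, Suc j))"
    have D: "D \<in> carrier_mat n n"
      by (simp add: D_def)
    have "transpose_mat D = D"
      using Bsym by (intro eq_matI) (auto simp: D_def)
    with Suc.IH[OF D] obtain U f where U: "similar_mat_wit D (mat_diag n f) U (transpose_mat U)"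
      by blast
    have Uc: "U \<in> carrier_mat n n"
      using similar_mat_witD2[OF D U] by auto
    let ?e = "mat 1 1 (\<lambda>_. e)"
    have blockB: "four_block_mat ?e (0\<^sub>m 1 n) (0\<^sub>m n 1) D = B"
    proof (rule eq_matI)
      fix i j assume "i < dim_row B" "j < dim_col B"
      then have "i < ?N" "j < ?N" using B by auto
      then show "four_block_mat ?e (0\<^sub>m 1 n) (0\<^sub>m n 1) D $$ (i, j) = B $$ (i, j)"
        using Bi0[of i] Bi0[of j] Bsym[of i j]
        by (cases i; cases j) (auto simp: D_def)
    qed (use B in \<open>auto simp: D_def\<close>)
    have blockD: "four_block_mat ?e (0\<^sub>m 1 n) (0\<^sub>m n 1) (mat_diag n f) = mat_diag ?N (case_nat e f)"
      by (rule eq_matI) (auto simp: mat_diag_def split: nat.splits)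
    let ?V = "four_block_mat (1\<^sub>m 1) (0\<^sub>m 1 n) (0\<^sub>m n 1) U"
    have V: "?V \<in> carrier_mat ?N ?N"
      using four_block_carrier_mat[OF one_carrier_mat[of 1] Uc] by simp
    have tV: "transpose_mat ?V = four_block_mat (1\<^sub>m 1) (0\<^sub>m 1 n) (0\<^sub>m n 1) (transpose_mat U)"
      using Uc by (subst transpose_four_block_mat) auto
    have "similar_mat_wit ?e ?e (1\<^sub>m 1) (1\<^sub>m 1)"
      by (rule similar_mat_wit_refl) simp
    from similar_mat_wit_four_block[OF this U, where n = 1 and m = n and UR = "0\<^sub>m 1 n" and LL = "0\<^sub>m n 1"
        and URA = "0\<^sub>m 1 n" and LLA = "0\<^sub>m n 1"]
    have sim1: "similar_mat_wit B (mat_diag ?N (case_nat e f)) ?V (transpose_mat ?V)"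
      using Uc unfolding blockB blockD tV by (simp add: D_def)
    have "W * B * W = (W * W) * A * (W * W)"
      using A W by (simp add: B_def assoc_mult_mat[of _ ?N ?N _ ?N _ ?N])
    then have "A = W * B * W"
      using A by (simp add: WW)
    then have "similar_mat_wit A B W W"
      using A B W WW by (intro similar_mat_witI)
    from similar_mat_wit_trans[OF this sim1]
    have "similar_mat_wit A (mat_diag ?N (case_nat e f)) (W * ?V) (transpose_mat (W * ?V))"
      using transpose_mult[OF W V] tW by simp
    then show ?case by blast
  qed
  then show thesis using that by blast
qed

section \<open>Orthogonally diagonalised matrices and their pseudoinverses\<close>

lemma trace_mult_commute:
  fixes A B :: "'a :: comm_semiring_0 mat"
  assumes "A \<in> carrier_mat n k" "B \<in> carrier_mat k n"
  shows "(\<Sum>i<n. (A * B) $$ (i, i)) = (\<Sum>i<k. (B * A) $$ (i, i))"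
proof -
  have "(\<Sum>i<n. (A * B) $$ (i, i)) = (\<Sum>i<n. \<Sum>j<k. A $$ (i, j) * B $$ (j, i))"
    using assms by (intro sum.cong) (auto simp: scalar_prod_def lessThan_atLeast0)
  also have "\<dots> = (\<Sum>j<k. \<Sum>i<n. B $$ (j, i) * A $$ (i, j))"
    by (subst sum.swap) (simp add: mult.commute)
  also have "\<dots> = (\<Sum>i<k. (B * A) $$ (i, i))"
    using assms by (intro sum.cong) (auto simp: scalar_prod_def lessThan_atLeast0)
  finally show ?thesis .
qed

text \<open>Penrose's argument: transposing a product of the symmetric matrices \<open>A * X\<close>
  and \<open>A * Y\<close> reverses the factors, which forces them to agree; likewise
  \<open>X * A = Y * A\<close>. Then X = XAX = YAX = YAY = Y.\<close>

lemma is_pinverse_unique: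
  assumes A: "A \<in> carrier_mat n k" and X: "is_pinverse A X" and Y: "is_pinverse A Y"
  shows "X = Y"
proof -
  have Xc: "X \<in> carrier_mat k n" and Yc: "Y \<in> carrier_mat k n"
    using A X Y by (auto simp: is_pinverse_def)
  have prods: "A * X \<in> carrier_mat n n" "A * Y \<in> carrier_mat n n"
      "X * A \<in> carrier_mat k k" "Y * A \<in> carrier_mat k k"
    using A Xc Yc by auto
  have 1: "A * X = A * Y"
  proof -
    have "A * X = A * Y * A * X"
      using Y by (simp add: is_pinverse_def)
    also have "\<dots> = (A * Y) * (A * X)"
      by (rule assoc_mult_mat[OF prods(2) A Xc])
    also have "\<dots> = transpose_mat (A * Y) * transpose_mat (A * X)"
      using X Y by (simp add: is_pinverse_def)
    also have "\<dots> = transpose_mat ((A * X) * (A * Y))"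
      by (rule transpose_mult[OF prods(1,2), symmetric])
    also have "(A * X) * (A * Y) = A * X * A * Y"
      by (rule assoc_mult_mat[OF prods(1) A Yc, symmetric])
    finally show ?thesis
      using X Y by (simp add: is_pinverse_def)
  qed
  have 2: "X * A = Y * A"
  proof -
    have "X * A = X * (A * Y * A)"
      using Y by (simp add: is_pinverse_def)
    also have "\<dots> = (X * A) * (Y * A)"
      by (simp only: assoc_mult_mat[OF A Yc A] assoc_mult_mat[OF Xc A prods(4)])
    also have "\<dots> = transpose_mat (X * A) * transpose_mat (Y * A)"
      using X Y by (simp add: is_pinverse_def)
    also have "\<dots> = transpose_mat ((Y * A) * (X * A))"
      by (rule transpose_mult[OF prods(4,3), symmetric])
    also have "(Y * A) * (X * A) = Y * (A * X * A)"
      by (simp only: assoc_mult_mat[OF A Xc A] assoc_mult_mat[OF Yc A prods(3)])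
    finally show ?thesis
      using X Y by (simp add: is_pinverse_def)
  qed
  have "X = X * A * X"
    using X by (simp add: is_pinverse_def)
  also have "\<dots> = Y * A * Y"
    by (simp only: 2 assoc_mult_mat[OF Yc A Xc] assoc_mult_mat[OF Yc A Yc] 1)
  also have "\<dots> = Y"
    using Y by (simp add: is_pinverse_def)
  finally show ?thesis .
qed

lemma pinverse_eqI:
  assumes "is_pinverse A X"
  shows "pinverse A = X"
  unfolding pinverse_def
  using assms is_pinverse_unique[of A "dim_row A" "dim_col A"] by blast

section \<open>Functional calculus in a fixed orthonormal eigenbasis\<close>

locale orthogonal_matrix =
  fixes n :: nat and U :: "real mat"
  assumes carrier: "U \<in> carrier_mat n n"
    and transpose_mult_self: "transpose_mat U * U = 1\<^sub>m n"
begin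

text \<open>With \<open>U\<close> fixed, the eigenvalue function \<open>f\<close> stands for the
  whole matrix: products and pseudoinverses become pointwise operations on \<open>f\<close>.\<close>

definition conj_diag :: "(nat \<Rightarrow> real) \<Rightarrow> real mat" where
  "conj_diag f = U * mat_diag n f * transpose_mat U"

lemma conj_diag_carrier [simp]: "conj_diag f \<in> carrier_mat n n"
  using carrier mat_diag_dim[of n f] by (simp add: conj_diag_def del: mat_diag_dim)

lemma transpose_conj_diag: "transpose_mat (conj_diag f) = conj_diag f"
proof -
  have "transpose_mat (mat_diag n f) = mat_diag n f"
    by (rule eq_matI) (auto simp: mat_diag_def)
  then show ?thesis
    using carrier mat_diag_dim[of n f] by (simp add: conj_diag_def transpose_mult[of _ n n _ n]
        assoc_mult_mat[of _ n n _ n _ n] del: mat_diag_dim)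
qed

lemma conj_diag_mult: "conj_diag f * conj_diag g = conj_diag (\<lambda>i. f i * g i)"
proof -
  let ?T = "transpose_mat U"
  have T: "?T \<in> carrier_mat n n" "mat_diag n f \<in> carrier_mat n n" "mat_diag n g \<in> carrier_mat n n"
      "mat_diag n (\<lambda>i. f i * g i) \<in> carrier_mat n n"
    using carrier by auto
  have "conj_diag f * conj_diag g = U * (mat_diag n f * ((?T * U) * (mat_diag n g * ?T)))"
    using carrier T by (simp add: conj_diag_def assoc_mult_mat[of _ n n _ n _ n] del: mat_diag_dim)
  also have "\<dots> = U * ((mat_diag n f * mat_diag n g) * ?T)"
    using carrier T by (simp add: transpose_mult_self assoc_mult_mat[of _ n n _ n _ n] del: mat_diag_diag mat_diag_dim)
  also have "\<dots> = conj_diag (\<lambda>i. f i * g i)"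
    using carrier T by (simp add: conj_diag_def assoc_mult_mat[of _ n n _ n _ n] del: mat_diag_dim)
  finally show ?thesis .
qed

text \<open>Cyclicity of the trace brings \<open>transpose_mat U\<close> next to \<open>U\<close>,
  where the two cancel.\<close>

lemma trace_conj_diag: "(\<Sum>i<n. conj_diag f $$ (i, i)) = (\<Sum>i<n. f i)"
proof -
  have "(\<Sum>i<n. conj_diag f $$ (i, i)) = (\<Sum>i<n. (transpose_mat U * (U * mat_diag n f)) $$ (i, i))"
    unfolding conj_diag_def using carrier by (intro trace_mult_commute) auto
  also have "transpose_mat U * (U * mat_diag n f) = mat_diag n f"
    using carrier mat_diag_dim[of n f] by (simp add: transpose_mult_self flip: assoc_mult_mat[of _ n n _ n _ n] del: mat_diag_dim)
  finally show ?thesis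
    by (simp add: mat_diag_def)
qed

text \<open>The convention \<open>inverse 0 = 0\<close> is exactly pseudoinversion of a scalar, so
  the Penrose conditions hold entry by entry, zero eigenvalues included.\<close>

lemma pinverse_conj_diag: "pinverse (conj_diag f) = conj_diag (\<lambda>i. inverse (f i))"
proof (rule pinverse_eqI)
  have [simp]: "f i * inverse (f i) * f i = f i"
    "inverse (f i) * f i * inverse (f i) = inverse (f i)" for i
    by (cases "f i = 0"; simp)+
  show "is_pinverse (conj_diag f) (conj_diag (\<lambda>i. inverse (f i)))"
    by (simp add: is_pinverse_def carrier_matD[OF conj_diag_carrier] conj_diag_mult transpose_conj_diag)
qed

lemma conj_diag_mult_col:
  assumes "i < n"
  shows "conj_diag f *\<^sub>v col U i = f i \<cdot>\<^sub>v col U i"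
proof -
  have "conj_diag f *\<^sub>v col U i = col (conj_diag f * U) i"
    by (rule col_mult2[OF conj_diag_carrier carrier assms, symmetric])
  also have "conj_diag f * U = U * mat_diag n f"
    using carrier mat_diag_dim[of n f]
    by (simp add: conj_diag_def assoc_mult_mat[of _ n n _ n _ n] transpose_mult_self del: mat_diag_dim)
  also have "col (U * mat_diag n f) i = f i \<cdot>\<^sub>v col U i"
    using carrier assms by (intro eq_vecI) (auto simp: mat_diag_mult_right)
  finally show ?thesis .
qed

lemma col_scalar_prod:
  assumes "i < n" "j < n"
  shows "col U i \<bullet> col U j = (if i = j then 1 else 0)"
  using arg_cong[OF transpose_mult_self, of "\<lambda>M. M $$ (i, j)"] assms carrier by simp

text \<open>This ties the unordered values of \<open>f\<close> to the sorted list of roots from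
  which \<open>lap_eig\<close> is read.\<close>

lemma proots_char_poly_conj_diag: "proots (char_poly (conj_diag f)) = image_mset f (mset_set {..<n})"
proof -
  have "U * transpose_mat U = 1\<^sub>m n"
    using mat_mult_left_right_inverse[OF _ carrier transpose_mult_self] carrier by simp
  then have "similar_mat (conj_diag f) (mat_diag n f)"
    using carrier transpose_mult_self by (intro similar_matI[of _ _ U "transpose_mat U" n]) (auto simp: conj_diag_def)
  then have "char_poly (conj_diag f) = char_poly (mat_diag n f)"
    by (rule char_poly_similar)
  also have "\<dots> = (\<Prod>a\<leftarrow>diag_mat (mat_diag n f). [:- a, 1:])"
    by (rule char_poly_upper_triangular) (auto simp: mat_diag_def)
  also have "diag_mat (mat_diag n f) = map f [0..<n]"
    by (auto simp: diag_mat_def mat_diag_def)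
  finally have "char_poly (conj_diag f) = (\<Prod>i\<in>{..<n}. [:- f i, 1:])"
    by (simp add: prod.list_conv_set_nth o_def lessThan_atLeast0)
  moreover have "(\<Sum>i\<in>I. {#f i#}) = image_mset f (mset_set I)" if "finite I" for I :: "nat set"
    using that by (induction I) auto
  ultimately show ?thesis
    by (simp add: proots_prod)
qed

end

lemma similar_mat_wit_conj_diag:
  assumes "A \<in> carrier_mat n n" "similar_mat_wit A (mat_diag n f) U (transpose_mat U)"
  shows "orthogonal_matrix n U" "A = orthogonal_matrix.conj_diag n U f"
proof -
  note * = similar_mat_witD2[OF assms]
  show U: "orthogonal_matrix n U"
    using * by unfold_locales auto
  show "A = orthogonal_matrix.conj_diag n U f"
    using * unfolding orthogonal_matrix.conj_diag_def[OF U] by (simp only:)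
qed

section \<open>The Laplacian of a graph\<close>

lemma simple_graph_finite:
  assumes "simple_graph n E"
  shows "finite E"
  using assms by (intro finite_subset[of E "Pow {..<n}"]) (auto simp: simple_graph_def)

text \<open>Degrees count edges while matrix rows run over vertices; sending \<open>j\<close> to
  \<open>{i, j}\<close> is the bijection between the two.\<close>

lemma card_neighbours:
  assumes G: "simple_graph n E" and "i < n"
  shows "card {j \<in> {..<n}. {i, j} \<in> E} = degree_of E i"
proof -
  have "bij_betw (\<lambda>j. {i, j}) {j \<in> {..<n}. {i, j} \<in> E} {e \<in> E. i \<in> e}"
    unfolding bij_betw_def
  proof
    show "inj_on (\<lambda>j. {i, j}) {j \<in> {..<n}. {i, j} \<in> E}"
      by (auto simp: inj_on_def doubleton_eq_iff)
    have "e \<in> (\<lambda>j. {i, j}) ` {j \<in> {..<n}. {i, j} \<in> E}" if e: "e \<in> E" "i \<in> e" for e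
    proof -
      have "card e = 2" "e \<subseteq> {..<n}" using G e by (auto simp: simple_graph_def)
      then obtain j where "e = {i, j}" using e by (auto simp: card_2_iff)
      then show ?thesis using e \<open>e \<subseteq> {..<n}\<close> by auto
    qed
    then show "(\<lambda>j. {i, j}) ` {j \<in> {..<n}. {i, j} \<in> E} = {e \<in> E. i \<in> e}"
      by auto
  qed
  then show ?thesis
    unfolding degree_of_def by (rule bij_betw_same_card)
qed

text \<open>Double counting of the incident pairs of a vertex and an edge.\<close>

lemma handshake:
  assumes G: "simple_graph n E"
  shows "(\<Sum>v<n. degree_of E v) = 2 * card E"
proof -
  note fin = simple_graph_finite[OF G]
  have "(\<Sum>v<n. degree_of E v) = (\<Sum>v<n. \<Sum>e | e \<in> E \<and> v \<in> e. 1)"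
    by (simp add: degree_of_def)
  also have "\<dots> = (\<Sum>e\<in>E. \<Sum>v | v \<in> {..<n} \<and> v \<in> e. 1)"
    using fin by (intro sum.swap_restrict) auto
  also have "\<dots> = (\<Sum>e\<in>E. 2)"
  proof (intro sum.cong refl)
    fix e assume "e \<in> E"
    then have "{v. v \<in> {..<n} \<and> v \<in> e} = e" "card e = 2"
      using G by (auto simp: simple_graph_def)
    then show "(\<Sum>v | v \<in> {..<n} \<and> v \<in> e. 1) = (2::nat)" by simp
  qed
  finally show ?thesis by simp
qed

section \<open>The Laplacian: quadratic form, kernel and trace of the square\<close>

lemma laplacian_carrier [simp]: "laplacian n E \<in> carrier_mat n n"
  unfolding laplacian_def degree_mat_def adjacency_mat_def by (intro carrier_matI) simp_all

lemma laplacian_index: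
  assumes "i < n" "j < n"
  shows "laplacian n E $$ (i, j) =
    (if i = j then real (degree_of E i) else 0) - of_bool ({i, j} \<in> E)"
  using assms by (simp add: laplacian_def degree_mat_def adjacency_mat_def)

lemma transpose_laplacian: "transpose_mat (laplacian n E) = laplacian n E"
  using laplacian_carrier[of n E]
  by (intro eq_matI) (auto simp: laplacian_index insert_commute simp del: laplacian_carrier)

text \<open>Distributing the degree over the neighbours turns each row into a sum of differences
  along edges, a form from which the quadratic form and the vanishing on constants can be read
  off.\<close>

lemma laplacian_mult_index:
  assumes G: "simple_graph n E" and x: "x \<in> carrier_vec n" and "i < n"
  shows "(laplacian n E *\<^sub>v x) $ i = (\<Sum>j<n. of_bool ({i, j} \<in> E) * (x $ i - x $ j))"
proof -
  have "(laplacian n E *\<^sub>v x) $ i = (\<Sum>j<n. laplacian n E $$ (i, j) * x $ j)"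
    using x \<open>i < n\<close> carrier_matD[OF laplacian_carrier[of n E]]
    by (simp add: scalar_prod_def lessThan_atLeast0)
  also have "\<dots> = (\<Sum>j<n. (if j = i then real (degree_of E i) * x $ i else 0)
      - of_bool ({i, j} \<in> E) * x $ j)"
    using \<open>i < n\<close> by (intro sum.cong) (auto simp: laplacian_index algebra_simps)
  also have "\<dots> = real (degree_of E i) * x $ i - (\<Sum>j<n. of_bool ({i, j} \<in> E) * x $ j)"
    using \<open>i < n\<close> by (simp add: sum_subtractf)
  also have "real (degree_of E i) = (\<Sum>j<n. of_bool ({i, j} \<in> E))"
    using card_neighbours[OF G \<open>i < n\<close>] by (simp add: sum_of_bool_eq Int_def conj_commute)
  finally show ?thesis
    by (simp add: sum_distrib_right sum_subtractf right_diff_distrib)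
qed

lemma laplacian_quadratic_form:
  assumes G: "simple_graph n E" and x: "x \<in> carrier_vec n"
  shows "2 * (x \<bullet> (laplacian n E *\<^sub>v x)) =
    (\<Sum>i<n. \<Sum>j<n. of_bool ({i, j} \<in> E) * (x $ i - x $ j)\<^sup>2)"
proof -
  let ?a = "\<lambda>i j. of_bool ({i, j} \<in> E) :: real"
  have "x \<bullet> (laplacian n E *\<^sub>v x) = (\<Sum>i<n. x $ i * (laplacian n E *\<^sub>v x) $ i)"
    using carrier_matD[OF laplacian_carrier[of n E]] by (simp add: scalar_prod_def lessThan_atLeast0)
  also have "\<dots> = (\<Sum>i<n. \<Sum>j<n. ?a i j * (x $ i * (x $ i - x $ j)))"
    by (simp add: laplacian_mult_index[OF G x] sum_distrib_left mult.left_commute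
        del: sum_of_bool_mult_eq sum_mult_of_bool_eq)
  finally have 1: "x \<bullet> (laplacian n E *\<^sub>v x) = (\<Sum>i<n. \<Sum>j<n. ?a i j * (x $ i * (x $ i - x $ j)))" .
  \<comment> \<open>Exchanging the roles of \<open>i\<close> and \<open>j\<close> and adding both
    versions completes the square.\<close>
  also have "\<dots> = (\<Sum>i<n. \<Sum>j<n. ?a i j * (x $ j * (x $ j - x $ i)))"
    by (subst sum.swap) (simp add: insert_commute)
  finally have "2 * (x \<bullet> (laplacian n E *\<^sub>v x)) =
      (\<Sum>i<n. \<Sum>j<n. ?a i j * (x $ i * (x $ i - x $ j)))
      + (\<Sum>i<n. \<Sum>j<n. ?a i j * (x $ j * (x $ j - x $ i)))"
    using 1 by simp
  also have "\<dots> = (\<Sum>i<n. \<Sum>j<n. ?a i j * (x $ i - x $ j)\<^sup>2)"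
    unfolding sum.distrib[symmetric]
    by (intro sum.cong refl) (simp add: power2_eq_square algebra_simps)
  finally show ?thesis .
qed

lemma laplacian_psd:
  assumes "simple_graph n E" "x \<in> carrier_vec n"
  shows "x \<bullet> (laplacian n E *\<^sub>v x) \<ge> 0"
proof -
  have "2 * (x \<bullet> (laplacian n E *\<^sub>v x)) \<ge> 0"
    unfolding laplacian_quadratic_form[OF assms] by (intro sum_nonneg) auto
  then show ?thesis by simp
qed

text \<open>A vanishing sum of squares makes \<open>x\<close> agree at the ends of every edge, and
  connectedness carries this along paths.\<close>

lemma laplacian_kernel_const:
  assumes G: "connected_graph n E" and x: "x \<in> carrier_vec n"
    and ker: "x \<bullet> (laplacian n E *\<^sub>v x) = 0" and uv: "u < n" "v < n"
  shows "x $ u = x $ v"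
proof -
  have sG: "simple_graph n E" and uv': "(u, v) \<in> {(x, y). {x, y} \<in> E}\<^sup>*"
    using G uv by (auto simp: connected_graph_def)
  have "(\<Sum>i<n. \<Sum>j<n. of_bool ({i, j} \<in> E) * (x $ i - x $ j)\<^sup>2) = 0"
    using laplacian_quadratic_form[OF sG x] ker by simp
  then have "of_bool ({i, j} \<in> E) * (x $ i - x $ j)\<^sup>2 = 0" if "i < n" "j < n" for i j
    using that by (simp add: sum_nonneg_eq_0_iff sum_nonneg)
  then have edge: "x $ i = x $ j" if "{i, j} \<in> E" for i j
    using that sG by (auto simp: simple_graph_def)
  show ?thesis
    using uv' by (induction rule: rtrancl_induct) (auto dest: edge)
qed

lemma laplacian_ones:
  assumes "simple_graph n E"
  shows "laplacian n E *\<^sub>v vec n (\<lambda>_. 1) = 0\<^sub>v n"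
  using carrier_matD[OF laplacian_carrier[of n E]]
  by (intro eq_vecI) (simp_all add: laplacian_mult_index[OF assms] del: index_mult_mat_vec)

text \<open>Row \<open>i\<close> contributes the square of its diagonal entry, the degree, and a
  further 1 for each neighbour. The squares add up to the Zagreb index, the degrees to twice the
  number of edges.\<close>

lemma trace_laplacian_sq:
  assumes G: "simple_graph n E"
  shows "(\<Sum>i<n. (laplacian n E * laplacian n E) $$ (i, i)) = 2 * real (card E) + real (zagreb1 n E)"
proof -
  have "(laplacian n E * laplacian n E) $$ (i, i) = (real (degree_of E i))\<^sup>2 + real (degree_of E i)"
    if "i < n" for i
  proof -
    have loop: "{i} \<notin> E"
      using G by (auto simp: simple_graph_def)
    have "(laplacian n E * laplacian n E) $$ (i, i) = (\<Sum>j<n. laplacian n E $$ (i, j) * laplacian n E $$ (j, i))"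
      using that carrier_matD[OF laplacian_carrier[of n E]]
      by (simp add: scalar_prod_def lessThan_atLeast0)
    also have "\<dots> = (\<Sum>j<n. (if j = i then (real (degree_of E i))\<^sup>2 else 0) + of_bool ({i, j} \<in> E))"
      using that loop
      by (intro sum.cong) (auto simp: laplacian_index insert_commute power2_eq_square)
    also have "\<dots> = (real (degree_of E i))\<^sup>2 + (\<Sum>j<n. of_bool ({i, j} \<in> E))"
      using that by (simp add: sum.distrib)
    also have "(\<Sum>j<n. of_bool ({i, j} \<in> E)) = real (degree_of E i)"
      using card_neighbours[OF G that] by (simp add: sum_of_bool_eq Int_def conj_commute)
    finally show ?thesis .
  qed
  moreover have "(\<Sum>i<n. real (degree_of E i)) = 2 * real (card E)"
    using arg_cong[OF handshake[OF G], of real] by simp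
  ultimately show ?thesis
    by (simp add: sum.distrib zagreb1_def)
qed

section \<open>The spectral bound\<close>

text \<open>Each value lies between \<open>l\<close> and \<open>u\<close>, so (a - l)(u - a) \<ge>
  0; dividing by a gives a linear bound on a + lu/a. Summing it and applying the inequality of
  arithmetic and geometric means separates the two sums.\<close>

lemma kantorovich_sum:
  fixes a :: "'i \<Rightarrow> real"
  assumes "l > 0" and bounds: "\<And>i. i \<in> I \<Longrightarrow> l \<le> a i \<and> a i \<le> u"
  shows "4 * l * u * (\<Sum>i\<in>I. a i) * (\<Sum>i\<in>I. inverse (a i)) \<le> (real (card I) * (l + u))\<^sup>2"
proof -
  let ?S = "\<Sum>i\<in>I. a i" and ?T = "\<Sum>i\<in>I. inverse (a i)"
  have bound: "a i + l * u * inverse (a i) \<le> l + u" if "i \<in> I" for i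
  proof -
    have "a i > 0" using bounds[OF that] \<open>l > 0\<close> by linarith
    have "0 \<le> (a i - l) * (u - a i)" using bounds[OF that] by simp
    then have "a i * a i + l * u \<le> (l + u) * a i" by (simp add: algebra_simps)
    then show ?thesis using \<open>a i > 0\<close> by (simp add: field_simps)
  qed
  have "?S + l * u * ?T = (\<Sum>i\<in>I. a i + l * u * inverse (a i))"
    by (simp add: sum.distrib sum_distrib_left)
  also have "\<dots> \<le> real (card I) * (l + u)"
    using sum_bounded_above[of I, OF bound] by simp
  finally have le: "?S + l * u * ?T \<le> real (card I) * (l + u)" .
  have nonneg: "a i \<ge> 0 \<and> l * u * inverse (a i) \<ge> 0" if "i \<in> I" for i
    using bounds[OF that] \<open>l > 0\<close> by auto
  have "?S + l * u * ?T \<ge> 0"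
    unfolding sum_distrib_left sum.distrib[symmetric] using nonneg by (intro sum_nonneg) auto
  have "4 * l * u * ?S * ?T = 4 * ?S * (l * u * ?T)"
    by simp
  also have "\<dots> \<le> (?S + l * u * ?T)\<^sup>2"
    using zero_le_power2[of "?S - l * u * ?T"] by (simp only: power2_eq_square) (simp add: algebra_simps)
  also have "\<dots> \<le> (real (card I) * (l + u))\<^sup>2"
    using le \<open>?S + l * u * ?T \<ge> 0\<close> by (rule power_mono)
  finally show ?thesis .
qed

text \<open>Each pair contributes two diagonal and two off-diagonal terms. The subtracted double sum
  is the quadratic form of \<open>Q\<close> at the all-ones vector, which vanishes when
  \<open>Q\<close> annihilates constants.\<close>

lemma sum_pair_differences:
  fixes Q :: "real mat"
  assumes Q: "Q \<in> carrier_mat n n"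
  shows "1 / 2 * (\<Sum>u<n. \<Sum>v<n. (unit_vec n u - unit_vec n v) \<bullet> (Q *\<^sub>v (unit_vec n u - unit_vec n v)))
    = real n * (\<Sum>i<n. Q $$ (i, i)) - (\<Sum>i<n. \<Sum>j<n. Q $$ (i, j))"
proof -
  have "(unit_vec n u - unit_vec n v) \<bullet> (Q *\<^sub>v (unit_vec n u - unit_vec n v))
      = Q $$ (u, u) + Q $$ (v, v) - Q $$ (u, v) - Q $$ (v, u)" if "u < n" "v < n" for u v
    using that Q
    by (simp add: mult_minus_distrib_mat_vec[of _ n n] minus_scalar_prod_distrib[of _ n]
        scalar_prod_minus_distrib[of _ n])
  then have "(\<Sum>u<n. \<Sum>v<n. (unit_vec n u - unit_vec n v) \<bullet> (Q *\<^sub>v (unit_vec n u - unit_vec n v)))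
      = (\<Sum>u<n. \<Sum>v<n. Q $$ (u, u) + Q $$ (v, v) - Q $$ (u, v) - Q $$ (v, u))"
    by simp
  also have "\<dots> = 2 * real n * (\<Sum>i<n. Q $$ (i, i)) - (\<Sum>u<n. \<Sum>v<n. Q $$ (u, v)) - (\<Sum>u<n. \<Sum>v<n. Q $$ (v, u))"
    by (simp add: sum.distrib sum_subtractf flip: sum_distrib_left)
  also have "(\<Sum>u<n. \<Sum>v<n. Q $$ (v, u)) = (\<Sum>u<n. \<Sum>v<n. Q $$ (u, v))"
    by (rule sum.swap)
  finally show ?thesis by simp
qed

text \<open>The values of \<open>f\<close> are the quadratic form at orthonormal eigenvectors, hence
  nonnegative, and the all-ones vector makes one of them zero. By connectedness a second zero would
  give two constant unit vectors, which cannot be orthogonal.\<close>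

lemma laplacian_conj_diag_kernel:
  assumes G: "connected_graph n E" and U: "orthogonal_matrix n U"
    and L: "laplacian n E = orthogonal_matrix.conj_diag n U f"
  obtains k where "k < n" "f k = 0" "\<And>i. i < n \<Longrightarrow> i \<noteq> k \<Longrightarrow> f i > 0"
proof -
  interpret orthogonal_matrix n U by fact
  have sG: "simple_graph n E" and "n > 0"
    using G by (auto simp: connected_graph_def)
  have cols: "col U i \<in> carrier_vec n" for i
    by (metis carrier carrier_matD(1) col_dim)
  have form: "col U i \<bullet> (laplacian n E *\<^sub>v col U i) = f i" if "i < n" for i
    using that cols[of i] by (simp add: L conj_diag_mult_col col_scalar_prod)
  have nonneg: "f i \<ge> 0" if "i < n" for i
    using laplacian_psd[OF sG cols[of i]] form[OF that] by simp
  have "eigenvector (laplacian n E) (vec n (\<lambda>_. 1)) 0"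
  proof -
    have "vec n (\<lambda>_. 1) $ 0 \<noteq> (0\<^sub>v n $ 0 :: real)" using \<open>n > 0\<close> by simp
    then have "vec n (\<lambda>_. 1) \<noteq> (0\<^sub>v n :: real vec)" by metis
    moreover have "(0::real) \<cdot>\<^sub>v vec n (\<lambda>_. 1) = 0\<^sub>v n" by (intro eq_vecI) auto
    ultimately show ?thesis
      using laplacian_ones[OF sG] carrier_matD[OF laplacian_carrier[of n E]]
      by (simp add: eigenvector_def)
  qed
  then have "poly (char_poly (laplacian n E)) 0 = 0"
    using eigenvalue_root_char_poly[OF laplacian_carrier] by (auto simp: eigenvalue_def)
  moreover have "char_poly (laplacian n E) \<noteq> 0"
    using degree_monic_char_poly[OF laplacian_carrier[of n E]] by auto
  ultimately have "0 \<in># proots (char_poly (laplacian n E))"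
    by simp
  then obtain k where k: "k < n" "f k = 0"
    by (auto simp: L proots_char_poly_conj_diag)
  have "f i \<noteq> 0" if i: "i < n" "i \<noteq> k" for i
  proof
    assume "f i = 0"
    have const: "col U j $ u = col U j $ 0" if "j < n" "f j = 0" "u < n" for j u
      using laplacian_kernel_const[OF G cols, of j u 0] form that \<open>n > 0\<close> by simp
    have prod: "col U j \<bullet> col U l = real n * (col U j $ 0 * col U l $ 0)"
      if "j < n" "f j = 0" "l < n" "f l = 0" for j l
    proof -
      have "col U j \<bullet> col U l = (\<Sum>u<n. col U j $ u * col U l $ u)"
        using carrier by (simp add: scalar_prod_def lessThan_atLeast0)
      also have "\<dots> = (\<Sum>u<n. col U j $ 0 * col U l $ 0)"
        using that by (intro sum.cong refl) (metis const lessThan_iff)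
      finally show ?thesis by simp
    qed
    \<comment> \<open>With a and b the constant entries of the two columns, orthonormality reads nab
      = 0, naa = 1 and nbb = 1, a contradiction.\<close>
    have "real n * (col U i $ 0 * col U k $ 0) = 0" "real n * (col U i $ 0 * col U i $ 0) = 1"
      "real n * (col U k $ 0 * col U k $ 0) = 1"
      using i k \<open>f i = 0\<close> prod col_scalar_prod by metis+
    then show False by auto
  qed
  with k nonneg show thesis
    by (intro that[of k]) (auto simp: less_le)
qed

text \<open>The single zero precedes the positive values in sorted order, so the entries at 1 and
  \<open>n - 1\<close> are the least and the greatest nonzero eigenvalue.\<close>

lemma sorted_eigenvalues_bounds:
  fixes f :: "nat \<Rightarrow> real"
  assumes roots: "proots (char_poly A) = image_mset f (mset_set {..<n})" and "n \<ge> 2"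
    and k: "k < n" "f k = 0" and pos: "\<And>i. i < n \<Longrightarrow> i \<noteq> k \<Longrightarrow> f i > 0"
  defines "s \<equiv> sorted_eigenvalues A"
  shows "s ! 1 > 0" and "\<And>i. i < n \<Longrightarrow> i \<noteq> k \<Longrightarrow> s ! 1 \<le> f i \<and> f i \<le> s ! (n - 1)"
proof -
  let ?I = "{..<n} - {k}"
  define t where "t = sorted_list_of_multiset (image_mset f (mset_set ?I))"
  have mset_t: "mset t = image_mset f (mset_set ?I)" and sorted_t: "sorted t"
    by (simp_all add: t_def)
  have set_t: "set t = f ` ?I"
    using arg_cong[OF mset_t, of set_mset] by simp
  have len: "length t = n - 1"
    using arg_cong[OF mset_t, of size] k by simp
  have "{..<n} = insert k ?I"
    using k by auto
  then have "mset_set {..<n} = add_mset k (mset_set ?I)"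
    by (metis Diff_iff finite_Diff finite_lessThan insertI1 mset_set.insert)
  then have "s = insort 0 t"
    by (simp add: s_def sorted_eigenvalues_def roots k t_def)
  also have "\<dots> = 0 # t"
    using pos set_t by (intro insort_is_Cons) (auto intro: less_imp_le)
  finally have s: "s = 0 # t" .
  \<comment> \<open>The leading zero shifts indices by one; \<open>n \<ge> 2\<close> guarantees that
    \<open>t\<close> is nonempty.\<close>
  have nth_s: "s ! 1 = t ! 0" "s ! (n - 1) = t ! (n - 2)"
    using \<open>n \<ge> 2\<close> by (auto simp: s nth_Cons' numeral_2_eq_2)
  have "t ! 0 \<in> set t"
    using len \<open>n \<ge> 2\<close> by simp
  then obtain i where "i < n" "i \<noteq> k" "t ! 0 = f i"
    by (auto simp: set_t)
  then show "s ! 1 > 0"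
    unfolding nth_s using pos[of i] by simp
  fix i assume "i < n" "i \<noteq> k"
  then have "f i \<in> set t"
    by (simp add: set_t)
  then obtain j where "j < length t" "t ! j = f i"
    by (auto simp: in_set_conv_nth)
  then show "s ! 1 \<le> f i \<and> f i \<le> s ! (n - 1)"
    using sorted_nth_mono[OF sorted_t, of 0 j] sorted_nth_mono[OF sorted_t, of j "n - 2"] len \<open>n \<ge> 2\<close>
    unfolding nth_s by simp
qed

text \<open>By \<open>sum_pair_differences\<close> the index is \<open>n\<close> times the trace of
  the squared pseudoinverse, less its total entry sum, which is zero. The sum may run over all
  indices because \<open>inverse 0 = 0\<close> discards the zero eigenvalue.\<close>

lemma biharmonic_index_conj_diag:
  assumes G: "simple_graph n E" and U: "orthogonal_matrix n U"
    and L: "laplacian n E = orthogonal_matrix.conj_diag n U f"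
  shows "biharmonic_index n E = real n * (\<Sum>i<n. inverse ((f i)\<^sup>2))"
proof -
  interpret orthogonal_matrix n U by fact
  define Q where "Q = conj_diag (\<lambda>i. inverse ((f i)\<^sup>2))"
  have Q: "Q \<in> carrier_mat n n"
    by (simp add: Q_def)
  have "pinverse (laplacian n E) ^\<^sub>m 2 = Q"
    by (simp add: L pinverse_conj_diag numeral_2_eq_2 conj_diag_mult Q_def
        carrier_matD[OF conj_diag_carrier] left_mult_one_mat[OF conj_diag_carrier])
  then have "biharmonic_index n E = real n * (\<Sum>i<n. Q $$ (i, i)) - (\<Sum>i<n. \<Sum>j<n. Q $$ (i, j))"
    by (simp add: biharmonic_index_def biharmonic_dist_sq_def Let_def flip: sum_pair_differences[OF Q])
  also have "(\<Sum>i<n. \<Sum>j<n. Q $$ (i, j)) = 0"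
  proof -
    let ?one = "vec n (\<lambda>_. 1) :: real vec"
    let ?C = "conj_diag (\<lambda>i. inverse (f i) * inverse ((f i)\<^sup>2))"
    \<comment> \<open>\<open>x\<inverse>\<^sup>2 = x\<inverse>\<^sup>3 \<cdot> x\<close>, also for \<open>x = 0\<close>, so \<open>Q\<close> inherits the kernel of the Laplacian.\<close>
    have "inverse ((f i)\<^sup>2) = inverse (f i) * inverse ((f i)\<^sup>2) * f i" for i
      by (cases "f i = 0") auto
    then have "Q = ?C * laplacian n E"
      by (simp only: L conj_diag_mult Q_def)
    then have "Q *\<^sub>v ?one = ?C *\<^sub>v (laplacian n E *\<^sub>v ?one)"
      using assoc_mult_mat_vec[OF conj_diag_carrier laplacian_carrier] by simp
    also have "\<dots> = 0\<^sub>v n"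
      by (intro eq_vecI)
        (simp_all add: laplacian_ones[OF G] scalar_prod_def carrier_matD[OF conj_diag_carrier])
    finally have Q0: "Q *\<^sub>v ?one = 0\<^sub>v n" .
    have "(\<Sum>j<n. Q $$ (i, j)) = 0" if "i < n" for i
      using arg_cong[OF Q0, of "\<lambda>x. x $ i"] that Q by (simp add: scalar_prod_def lessThan_atLeast0)
    then show ?thesis by simp
  qed
  finally show ?thesis
    by (simp add: Q_def trace_conj_diag)
qed

theorem theorem3p1:
  fixes n m :: nat and E :: "nat set set"
  assumes "n \<ge> 2"
    and "connected_graph n E"
    and "card E = m"
  shows "biharmonic_index n E \<le>
    real n * (real n - 1)\<^sup>2 / (4 * (2 * real m + real (zagreb1 n E))) *
      (spectral_ratio n E + 1 / spectral_ratio n E)\<^sup>2"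
proof -
  have G: "simple_graph n E"
    using assms by (simp add: connected_graph_def)
  obtain U f where "similar_mat_wit (laplacian n E) (mat_diag n f) U (transpose_mat U)"
    using real_spectral_theorem[OF laplacian_carrier transpose_laplacian] .
  note UL = similar_mat_wit_conj_diag[OF laplacian_carrier this]
  interpret orthogonal_matrix n U by (rule UL(1))
  note L = UL(2)
  obtain k where k: "k < n" "f k = 0" and pos: "\<And>i. i < n \<Longrightarrow> i \<noteq> k \<Longrightarrow> f i > 0"
    by (rule laplacian_conj_diag_kernel[OF assms(2) UL]) blast
  define I where "I = {..<n} - {k}"
  define l where "l = lap_eig n E 2"
  define u where "u = lap_eig n E n"
  define S where "S = (\<Sum>i\<in>I. (f i)\<^sup>2)"
  define T where "T = (\<Sum>i\<in>I. inverse ((f i)\<^sup>2))"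
  \<comment> \<open>Index \<open>k\<close> adds nothing to either spectral sum, since both its
    square and the inverse of that square are 0.\<close>
  have split: "(\<Sum>i<n. h i) = h k + (\<Sum>i\<in>I. h i)" for h :: "nat \<Rightarrow> real"
    using k by (simp add: I_def sum.remove)
  have card_I: "real (card I) = real n - 1"
    using k by (simp add: I_def of_nat_diff)
  \<comment> \<open>A nonzero eigenvalue exists, which yields \<open>u > 0\<close> and
    \<open>S > 0\<close> and so legitimises the divisions below.\<close>
  then have "I \<noteq> {}"
    using \<open>n \<ge> 2\<close> by auto
  note roots = proots_char_poly_conj_diag[of f, folded L]
  have "l > 0" and lu: "\<And>i. i \<in> I \<Longrightarrow> l \<le> f i \<and> f i \<le> u"
    using sorted_eigenvalues_bounds[OF roots assms(1) k pos]
    by (simp_all add: l_def u_def lap_eig_def I_def)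
  with \<open>I \<noteq> {}\<close> have "u > 0" by force
  have S: "2 * real m + real (zagreb1 n E) = S"
    using trace_laplacian_sq[OF G] trace_conj_diag[of "\<lambda>i. f i * f i"] split[of "\<lambda>i. f i * f i"]
    by (simp add: L conj_diag_mult assms(3) S_def power2_eq_square k)
  have BH: "biharmonic_index n E = real n * T"
    using biharmonic_index_conj_diag[OF G UL] split[of "\<lambda>i. inverse ((f i)\<^sup>2)"]
    by (simp add: T_def k)
  have "S > 0"
    unfolding S_def
  proof (rule sum_pos)
    show "(f i)\<^sup>2 > 0" if "i \<in> I" for i
      using that pos[of i] by (simp add: I_def)
  qed (use \<open>I \<noteq> {}\<close> in \<open>auto simp: I_def\<close>)
  \<comment> \<open>Kantorovich is applied to the squared eigenvalues, so the bounds are squared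
    too; positivity of \<open>l\<close> keeps squaring monotone.\<close>
  have "4 * l\<^sup>2 * u\<^sup>2 * S * T \<le> ((real n - 1) * (l\<^sup>2 + u\<^sup>2))\<^sup>2"
    unfolding S_def T_def card_I[symmetric]
  proof (rule kantorovich_sum)
    show "l\<^sup>2 \<le> (f i)\<^sup>2 \<and> (f i)\<^sup>2 \<le> u\<^sup>2" if "i \<in> I" for i
      using lu[OF that] \<open>l > 0\<close> by (intro conjI power_mono) linarith+
  qed (use \<open>l > 0\<close> in simp)
  then have "T * (4 * l\<^sup>2 * u\<^sup>2 * S) \<le> ((real n - 1) * (l\<^sup>2 + u\<^sup>2))\<^sup>2"
    by (simp only: mult_ac)
  then have "T \<le> ((real n - 1) * (l\<^sup>2 + u\<^sup>2))\<^sup>2 / (4 * l\<^sup>2 * u\<^sup>2 * S)"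
    using \<open>S > 0\<close> \<open>l > 0\<close> \<open>u > 0\<close> by (subst pos_le_divide_eq) simp_all
  \<comment> \<open>Moving the factor \<open>l\<^sup>2 * u\<^sup>2\<close> inside the square is what
    produces the ratio and its reciprocal.\<close>
  also have "\<dots> = (real n - 1)\<^sup>2 / (4 * S) * ((l\<^sup>2 + u\<^sup>2) / (l * u))\<^sup>2"
    by (simp add: power_mult_distrib power_divide)
  also have "(l\<^sup>2 + u\<^sup>2) / (l * u) = u / l + 1 / (u / l)"
    using \<open>l > 0\<close> \<open>u > 0\<close> by (simp add: field_simps power2_eq_square)
  finally have "real n * T \<le> real n * ((real n - 1)\<^sup>2 / (4 * S) * (u / l + 1 / (u / l))\<^sup>2)"
    by (intro mult_left_mono) auto
  then show ?thesis
    unfolding BH S spectral_ratio_def l_def[symmetric] u_def[symmetric] by simp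
qed

end
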